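(* If $p=\langle H, f, f^{-},c\rangle$ is a loopless $p$-dialectical system with connectives, in which $f^-=\neg$, then $A_p$ is both a dialectical completion, and a $q$-dialectical completion.
   Context: An enumeration operator $H$ is a c.e. set of pairs $\langle x,D\rangle$ with $D$ finite, acting by $H(X)=\{x: \exists D\subseteq X\, \langle x,D\rangle\in H\}$. A $p$-dialectical system is $p=\langle H,f,f^-,c\rangle$ with $H$ an algebraic closure enumeration operator ($X\subseteq H(X)$, $H(H(X))\subseteq H(X)$) such that $H(\emptyset)\ne\emptyset$ and $H(\{c\})=\omega$, $f$ (with $f_i=f(i)$) a computable permutation of $\omega$, $f^-$ a computable function all of whose orbits are infinite, $c$ the contradiction. Given a computable approximation $\alpha=\{H_s\}$ to $H$, the procedure maintains stacks $r_s(x)$ with tops $\rho_s(x)$, $m(s)$, $L_s(x)=\{\rho_s(y):y<x,\ r_s(y)\ne\langle\ \rangle\}$, $\chi_s(i)=H_s(L_s(i+1))$: stage $0$ has $m(0)=0$, $r_0(0)=\langle f_0\rangle$, other stacks empty; at stage $s+1$ with $m=m(s)$, (1) if no $k\le m$ has $c\in\chi_s(k)$, set $m(s+1)=m+1$, $r_{s+1}(m+1)=\langle f_{m+1}\rangle$, keep lower stacks, empty higher ones; (2) otherwise with $z$ least such $k$, set $m(s+1)=z$, keep stacks $<z$, $r_{s+1}(z)=r_s(z)^\frown\langle f^-(\rho_s(z))\rangle$, empty higher ones. $A_{s+1}=\bigcup_{i<m(s+1)}\chi_{s+1}(i)$ and $A_p=\{f_x:\exists t\,\forall s\ge t\,f_x\in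 A_s\}$. The system is loopless if for every $u$ the set $\{\rho_s(u):s\in\omega\}$ is finite. A dialectical system $d=\langle H,f,c\rangle$ has the same ingredients without $f^-$ and the same procedure except that clause (2) becomes: if $c\in H_s(\emptyset)$, set $m(s+1)=0$, $r_{s+1}(0)=\langle f_0\rangle$, other stacks empty; otherwise set $m(s+1)=z+1$, keep stacks $<z$, $r_{s+1}(z+1)=\langle f_{z+1}\rangle$, $r_{s+1}(x)$ empty for $x=z$ or $x>z+1$; final theses $A_d$. A $q$-dialectical system $q=\langle H,f,f^-,c,c^-\rangle$ has $H,f,f^-,c$ as for $p$-systems and $c^-\in\omega\smallsetminus\mathrm{range}(f^-)$; its procedure at stage $s+1$: (1) if no $k\le m$ has $\{c,c^-\}\cap\chi_s(k)\ne\emptyset$, act as clause (1) above; (2) if some $k\le m$ has $c\in\chi_s(k)$ and $c^-\notin\chi_s(k')$ for $k'<k$, act as the dialectical clause (2) with $z$ the least such $k$; (3) if some $k\le m$ has $c^-\in\chi_s(k)$ and $c\notin\chi_s(k')$ for $k'\le k$, act as the $p$-dialectical clause (2) with $z$ the least such $k$. Its final theses w.r.t. $\alpha$ are $A_q^\alpha$; $(q,\alpha)$ is loopless if each $\{\rho_s(u):s\in\omega\}$ is finite. A system with connectives is a system whose $H$ and $c$ come with injective computable $\neg,\rightarrow,\wedge,\lor$ such that for all $X$, $x$, $y$: $c\in H(\{x,\neg x\})$; $H(\{\neg\neg x\})=H(\{x\})$; $x\lor\neg x\in H(\emptyset)$; $H(X\cup\{x\lor y\})=H(X\cup\{x\})\cap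 H(X\cup\{y\})$; if $c\in H(X\cup\{x\})$ then $\neg x\in H(X)$; $x\in H(X\cup\{y\})$ iff $y\rightarrow x\in H(X)$. Its final theses $A$ form a completion if for every $x$, $A\cap\{x,\neg x\}$ has exactly one element. A dialectical (resp. $q$-dialectical) completion is the final-theses set of a dialectical system (resp. of a loopless approximated $q$-dialectical system) with connectives which is a completion. *)

theory Defs
  imports "HOL-Library.Nat_Bijection"
begin

text \<open>Partial recursive functions: programs and their (partial) evaluation.
  \<open>Proj\<close> counts arguments from 0, and \<open>Zero\<close> and \<open>Proj\<close> may be used at every arity;
  \<open>PrimRec\<close> and \<open>Mu\<close> put the recursion (resp. search) variable first.\<close>

datatype recfn = Zero | Succ | Proj nat | Comp recfn "recfn list" | PrimRec recfn recfn | Mu recfn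

inductive evaluates :: "recfn \<Rightarrow> nat list \<Rightarrow> nat \<Rightarrow> bool" where
  zero: "evaluates Zero xs 0"
| succ: "evaluates Succ [x] (Suc x)"
| proj: "i < length xs \<Longrightarrow> evaluates (Proj i) xs (xs ! i)"
| comp: "list_all2 (\<lambda>g y. evaluates g xs y) gs ys \<Longrightarrow> evaluates h ys z
    \<Longrightarrow> evaluates (Comp h gs) xs z"
| primrec_0: "evaluates g xs y \<Longrightarrow> evaluates (PrimRec g h) (0 # xs) y"
| primrec_Suc: "evaluates (PrimRec g h) (n # xs) y \<Longrightarrow> evaluates h (n # y # xs) z
    \<Longrightarrow> evaluates (PrimRec g h) (Suc n # xs) z"
| mu: "evaluates g (n # xs) 0 \<Longrightarrow> (\<And>k. k < n \<Longrightarrow> \<exists>y. evaluates g (k # xs) (Suc y))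
    \<Longrightarrow> evaluates (Mu g) xs n"

inductive_cases evaluates_elims:
  "evaluates Zero xs z" "evaluates Succ xs z" "evaluates (Proj i) xs z"
  "evaluates (Comp h gs) xs z" "evaluates (PrimRec g h) (0 # xs) z"
  "evaluates (PrimRec g h) (Suc n # xs) z" "evaluates (Mu g) xs z"

lemma evaluates_unique: "evaluates e xs y \<Longrightarrow> evaluates e xs z \<Longrightarrow> y = z"
proof (induction arbitrary: z rule: evaluates.induct)
  case (comp xs gs ys h w)
  from comp.prems obtain ys'
    where a: "list_all2 (\<lambda>g y. evaluates g xs y) gs ys'" "evaluates h ys' z"
    by (rule evaluates_elims(4))
  have "ys = ys'"
    using comp.IH(1) a(1) by (auto simp: list_all2_conv_all_nth intro!: nth_equalityI)
  then show ?case using comp.IH(2) a(2) by simp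
next
  case (mu g n xs)
  have a: "evaluates g (z # xs) 0" "\<And>k. k < z \<Longrightarrow> \<exists>y. evaluates g (k # xs) (Suc y)"
    using mu.prems by (rule evaluates_elims(7), simp)+
  have "\<not> n < z" using a(2)[of n] mu.IH(1) by auto
  moreover have "\<not> z < n" using a(1) mu.IH(2)[of z] by auto
  ultimately show ?case by simp
next
  case (primrec_Suc g h n xs y w)
  from primrec_Suc.prems obtain y' where "evaluates (PrimRec g h) (n # xs) y'"
      "evaluates h (n # y' # xs) z"
    by (rule evaluates_elims(6))
  then show ?case using primrec_Suc.IH by blast
qed (blast elim: evaluates_elims)+

definition computable :: "(nat \<Rightarrow> nat) \<Rightarrow> bool" where
  "computable g \<longleftrightarrow> (\<exists>e. \<forall>x. evaluates e [x] (g x))"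

definition computable2 :: "(nat \<Rightarrow> nat \<Rightarrow> nat) \<Rightarrow> bool" where
  "computable2 g \<longleftrightarrow> (\<exists>e. \<forall>x y. evaluates e [x, y] (g x y))"

definition ce :: "nat set \<Rightarrow> bool" where
  "ce A \<longleftrightarrow> (\<exists>e. A = {x. \<exists>y. evaluates e [x] y})"


text \<open>Sets of axioms \<open>\<langle>x, D\<rangle>\<close>. For finite \<open>D\<close>, \<open>set_encode D\<close> is its canonical index.\<close>

type_synonym axioms = "(nat \<times> nat set) set"

definition axiom_code :: "nat \<times> nat set \<Rightarrow> nat" where
  "axiom_code = (\<lambda>(x, D). prod_encode (x, set_encode D))"

definition enumeration_operator :: "axioms \<Rightarrow> bool" where
  "enumeration_operator H \<longleftrightarrow> (\<forall>(x, D) \<in> H. finite D) \<and> ce (axiom_code ` H)"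

definition app :: "axioms \<Rightarrow> nat set \<Rightarrow> nat set" where
  "app H X = {x. \<exists>D. D \<subseteq> X \<and> (x, D) \<in> H}"

definition algebraic_closure :: "axioms \<Rightarrow> bool" where
  "algebraic_closure H \<longleftrightarrow>
     enumeration_operator H \<and> (\<forall>X. X \<subseteq> app H X) \<and> (\<forall>X. app H (app H X) \<subseteq> app H X)"

text \<open>A computable approximation is an increasing strong array of finite sets of axioms:
  the canonical index of \<open>\<alpha> s\<close> is computable from \<open>s\<close>.\<close>

definition computable_approximation :: "axioms \<Rightarrow> (nat \<Rightarrow> axioms) \<Rightarrow> bool" where
  "computable_approximation H \<alpha> \<longleftrightarrow>
     (\<forall>s. finite (\<alpha> s)) \<and> (\<forall>s. \<alpha> s \<subseteq> \<alpha> (Suc s)) \<and> (\<Union>s. \<alpha> s) = H \<and>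
     computable (\<lambda>s. set_encode (axiom_code ` \<alpha> s))"


definition dialectical_system :: "axioms \<Rightarrow> (nat \<Rightarrow> nat) \<Rightarrow> nat \<Rightarrow> bool" where
  "dialectical_system H f c \<longleftrightarrow>
     algebraic_closure H \<and> app H {} \<noteq> {} \<and> app H {c} = UNIV \<and> computable f \<and> bij f"

definition p_dialectical_system ::
    "axioms \<Rightarrow> (nat \<Rightarrow> nat) \<Rightarrow> (nat \<Rightarrow> nat) \<Rightarrow> nat \<Rightarrow> bool" where
  "p_dialectical_system H f fm c \<longleftrightarrow>
     dialectical_system H f c \<and> computable fm \<and> (\<forall>x. infinite {(fm ^^ n) x |n. True})"

definition q_dialectical_system ::
    "axioms \<Rightarrow> (nat \<Rightarrow> nat) \<Rightarrow> (nat \<Rightarrow> nat) \<Rightarrow> nat \<Rightarrow> nat \<Rightarrow> bool" where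
  "q_dialectical_system H f fm c cm \<longleftrightarrow> p_dialectical_system H f fm c \<and> cm \<notin> range fm"


text \<open>A state \<open>(m, r)\<close> consists of \<open>m(s)\<close> and the stacks \<open>r\<^sub>s(x)\<close>; the top of a stack is its
  last entry.\<close>

type_synonym state = "nat \<times> (nat \<Rightarrow> nat list)"

definition tops_below :: "(nat \<Rightarrow> nat list) \<Rightarrow> nat \<Rightarrow> nat set" where
  "tops_below r x = {last (r y) |y. y < x \<and> r y \<noteq> []}"

definition chi :: "axioms \<Rightarrow> (nat \<Rightarrow> nat list) \<Rightarrow> nat \<Rightarrow> nat set" where
  "chi Hs r i = app Hs (tops_below r (i + 1))"

definition start :: "(nat \<Rightarrow> nat) \<Rightarrow> state" where
  "start f = (0, \<lambda>x. if x = 0 then [f 0] else [])"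

definition advance :: "(nat \<Rightarrow> nat) \<Rightarrow> state \<Rightarrow> state" where
  "advance f = (\<lambda>(m, r).
     (m + 1, \<lambda>x. if x < m + 1 then r x else if x = m + 1 then [f (m + 1)] else []))"

definition replace_at :: "(nat \<Rightarrow> nat) \<Rightarrow> nat \<Rightarrow> state \<Rightarrow> state" where
  "replace_at fm z = (\<lambda>(m, r).
     (z, \<lambda>x. if x < z then r x else if x = z then r z @ [fm (last (r z))] else []))"

definition discard_at :: "(nat \<Rightarrow> nat) \<Rightarrow> nat \<Rightarrow> axioms \<Rightarrow> nat \<Rightarrow> state \<Rightarrow> state" where
  "discard_at f c Hs z = (\<lambda>(m, r).
     if c \<in> app Hs {} then start f
     else (z + 1, \<lambda>x. if x < z then r x else if x = z + 1 then [f (z + 1)] else []))"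

definition d_step :: "(nat \<Rightarrow> nat) \<Rightarrow> nat \<Rightarrow> axioms \<Rightarrow> state \<Rightarrow> state" where
  "d_step f c Hs = (\<lambda>(m, r).
     if \<exists>k\<le>m. c \<in> chi Hs r k
     then discard_at f c Hs (LEAST k. k \<le> m \<and> c \<in> chi Hs r k) (m, r)
     else advance f (m, r))"

definition p_step :: "(nat \<Rightarrow> nat) \<Rightarrow> (nat \<Rightarrow> nat) \<Rightarrow> nat \<Rightarrow> axioms \<Rightarrow> state \<Rightarrow> state" where
  "p_step f fm c Hs = (\<lambda>(m, r).
     if \<exists>k\<le>m. c \<in> chi Hs r k
     then replace_at fm (LEAST k. k \<le> m \<and> c \<in> chi Hs r k) (m, r)
     else advance f (m, r))"

text \<open>If neither of the first two conditions holds in \<open>q_step\<close>, then no \<open>chi Hs r k\<close> with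
  \<open>k \<le> m\<close> contains \<open>c\<close> or \<open>cm\<close>; the two conditions exclude each other.\<close>

definition q_step ::
    "(nat \<Rightarrow> nat) \<Rightarrow> (nat \<Rightarrow> nat) \<Rightarrow> nat \<Rightarrow> nat \<Rightarrow> axioms \<Rightarrow> state \<Rightarrow> state" where
  "q_step f fm c cm Hs = (\<lambda>(m, r).
     let C = \<lambda>k. k \<le> m \<and> c \<in> chi Hs r k \<and> (\<forall>k'<k. cm \<notin> chi Hs r k');
         D = \<lambda>k. k \<le> m \<and> cm \<in> chi Hs r k \<and> (\<forall>k'\<le>k. c \<notin> chi Hs r k')
     in if \<exists>k. C k then discard_at f c Hs (LEAST k. C k) (m, r)
        else if \<exists>k. D k then replace_at fm (LEAST k. D k) (m, r)
        else advance f (m, r))"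

primrec run :: "(nat \<Rightarrow> nat) \<Rightarrow> (axioms \<Rightarrow> state \<Rightarrow> state) \<Rightarrow> (nat \<Rightarrow> axioms) \<Rightarrow> nat \<Rightarrow> state" where
  "run f step \<alpha> 0 = start f"
| "run f step \<alpha> (Suc s) = step (\<alpha> s) (run f step \<alpha> s)"

definition theses ::
    "(nat \<Rightarrow> nat) \<Rightarrow> (axioms \<Rightarrow> state \<Rightarrow> state) \<Rightarrow> (nat \<Rightarrow> axioms) \<Rightarrow> nat \<Rightarrow> nat set" where
  "theses f step \<alpha> s = (case run f step \<alpha> s of (m, r) \<Rightarrow> \<Union>i<m. chi (\<alpha> s) r i)"

definition final_theses ::
    "(nat \<Rightarrow> nat) \<Rightarrow> (axioms \<Rightarrow> state \<Rightarrow> state) \<Rightarrow> (nat \<Rightarrow> axioms) \<Rightarrow> nat set" where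
  "final_theses f step \<alpha> = {f x |x. \<exists>t. \<forall>s\<ge>t. f x \<in> theses f step \<alpha> s}"

definition loopless ::
    "(nat \<Rightarrow> nat) \<Rightarrow> (axioms \<Rightarrow> state \<Rightarrow> state) \<Rightarrow> (nat \<Rightarrow> axioms) \<Rightarrow> bool" where
  "loopless f step \<alpha> \<longleftrightarrow>
     (\<forall>u. finite {last (r u) |r. (\<exists>s m. run f step \<alpha> s = (m, r)) \<and> r u \<noteq> []})"


definition connectives ::
    "axioms \<Rightarrow> nat \<Rightarrow> (nat \<Rightarrow> nat) \<Rightarrow> (nat \<Rightarrow> nat \<Rightarrow> nat) \<Rightarrow> (nat \<Rightarrow> nat \<Rightarrow> nat)
      \<Rightarrow> (nat \<Rightarrow> nat \<Rightarrow> nat) \<Rightarrow> bool" where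
  "connectives H c neg imp con dis \<longleftrightarrow>
     computable neg \<and> inj neg \<and>
     computable2 imp \<and> inj (\<lambda>(x, y). imp x y) \<and>
     computable2 con \<and> inj (\<lambda>(x, y). con x y) \<and>
     computable2 dis \<and> inj (\<lambda>(x, y). dis x y) \<and>
     (\<forall>x. c \<in> app H {x, neg x}) \<and>
     (\<forall>x. app H {neg (neg x)} = app H {x}) \<and>
     (\<forall>x. dis x (neg x) \<in> app H {}) \<and>
     (\<forall>X x y. app H (X \<union> {dis x y}) = app H (X \<union> {x}) \<inter> app H (X \<union> {y})) \<and>
     (\<forall>X x. c \<in> app H (X \<union> {x}) \<longrightarrow> neg x \<in> app H X) \<and>
     (\<forall>X x y. x \<in> app H (X \<union> {y}) \<longleftrightarrow> imp y x \<in> app H X)"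

definition completion :: "(nat \<Rightarrow> nat) \<Rightarrow> nat set \<Rightarrow> bool" where
  "completion neg A \<longleftrightarrow> (\<forall>x. card (A \<inter> {x, neg x}) = 1)"

definition dialectical_completion :: "nat set \<Rightarrow> bool" where
  "dialectical_completion A \<longleftrightarrow>
     (\<exists>H f c neg imp con dis \<alpha>.
        dialectical_system H f c \<and> connectives H c neg imp con dis \<and>
        computable_approximation H \<alpha> \<and>
        A = final_theses f (d_step f c) \<alpha> \<and> completion neg A)"

definition q_dialectical_completion :: "nat set \<Rightarrow> bool" where
  "q_dialectical_completion A \<longleftrightarrow>
     (\<exists>H f fm c cm neg imp con dis \<alpha>.
        q_dialectical_system H f fm c cm \<and> connectives H c neg imp con dis \<and>
        computable_approximation H \<alpha> \<and> loopless f (q_step f fm c cm) \<alpha> \<and>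
        A = final_theses f (q_step f fm c cm) \<alpha> \<and> completion neg A)"

end

theory Submission imports Defs begin

text \<open>Looplessness forces \<open>c \<notin> H(\<emptyset>)\<close>, since otherwise slot 0 would be replaced forever. Suppose
  the tops below slot \<open>u\<close> have settled to a consistent set \<open>L\<close>. Slot \<open>u\<close> then starts with
  \<open>f\<^sub>u\<close>, and it is revised only if \<open>L \<union> {f\<^sub>u}\<close> is inconsistent. In that case \<open>\<not> f\<^sub>u \<in> H(L)\<close>, so
  replacing \<open>f\<^sub>u\<close> by \<open>\<not> f\<^sub>u\<close> (as the \<open>p\<close>-procedure does) and dropping it (as the dialectical
  procedure does) generate the same closure. Hence both procedures, run on the same \<open>H\<close>, \<open>f\<close>,
  \<open>c\<close> and \<open>\<alpha>\<close>, compute the closure of the set built greedily along \<open>f\<close>, and the existence of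
  \<open>\<not>\<close> makes it a completion. Taking \<open>c\<^sup>- = c\<close> and any \<open>f\<^sup>-\<close> that omits \<open>c\<close>, the
  \<open>q\<close>-procedure coincides with the dialectical one.\<close>

section \<open>Algebraic closure operators and their computable approximations\<close>

lemma app_mono: "H \<subseteq> H' \<Longrightarrow> X \<subseteq> Y \<Longrightarrow> app H X \<subseteq> app H' Y"
  unfolding app_def by blast

lemma subset_app: "algebraic_closure H \<Longrightarrow> X \<subseteq> app H X"
  unfolding algebraic_closure_def by blast

lemma app_absorb:
  assumes "algebraic_closure H" and "X \<subseteq> app H Y"
  shows "app H X \<subseteq> app H Y"
proof -
  have "app H X \<subseteq> app H (app H Y)"
    using assms(2) by (intro app_mono) auto
  also have "\<dots> \<subseteq> app H Y"
    using assms(1) by (auto simp: algebraic_closure_def)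
  finally show ?thesis .
qed

lemma app_insert_absorb:
  assumes "algebraic_closure H" and "x \<in> app H X"
  shows "app H (insert x X) = app H X"
proof
  show "app H (insert x X) \<subseteq> app H X"
    using assms subset_app[OF assms(1), of X] by (intro app_absorb) auto
qed (intro app_mono; auto)

text \<open>Needed because the stack tops and the greedily built set agree only up to closure, not
  as sets.\<close>

lemma app_insert_cong:
  assumes "algebraic_closure H" and "app H X = app H Y"
  shows "app H (insert x X) = app H (insert x Y)"
proof -
  have *: "app H (insert x X) \<subseteq> app H (insert x Y)" if "app H X = app H Y" for X Y
  proof (rule app_absorb[OF assms(1)])
    have "X \<subseteq> app H Y"
      using that subset_app[OF assms(1), of X] by simp
    moreover have "app H Y \<subseteq> app H (insert x Y)"
      by (intro app_mono) auto
    moreover have "x \<in> app H (insert x Y)"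
      using subset_app[OF assms(1)] by blast
    ultimately show "insert x X \<subseteq> app H (insert x Y)" by auto
  qed
  show ?thesis using *[OF assms(2)] *[OF assms(2)[symmetric]] by auto
qed

lemma approximation_mono:
  assumes "computable_approximation H \<alpha>" and "s \<le> t"
  shows "\<alpha> s \<subseteq> \<alpha> t"
  by (rule lift_Suc_mono_le[OF _ assms(2)]) (use assms(1) in \<open>simp add: computable_approximation_def\<close>)

lemma approximation_subset: "computable_approximation H \<alpha> \<Longrightarrow> \<alpha> s \<subseteq> H"
  by (auto simp: computable_approximation_def)

lemma app_approximation:
  assumes "computable_approximation H \<alpha>" and "x \<in> app H X"
  shows "\<exists>t. \<forall>s\<ge>t. x \<in> app (\<alpha> s) X"
proof -
  obtain D where D: "D \<subseteq> X" "(x, D) \<in> H"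
    using assms(2) by (auto simp: app_def)
  then obtain t where "(x, D) \<in> \<alpha> t"
    using assms(1) by (auto simp: computable_approximation_def)
  then show ?thesis
    using D approximation_mono[OF assms(1)] unfolding app_def by blast
qed

section \<open>Tops of the lower slots\<close>

lemma tops_below_cong: "(\<And>v. v < u \<Longrightarrow> r v = r' v) \<Longrightarrow> tops_below r u = tops_below r' u"
  by (force simp: tops_below_def)

lemma tops_below_0 [simp]: "tops_below r 0 = {}"
  by (simp add: tops_below_def)

lemma tops_below_Suc:
  "tops_below r (Suc u) =
     (if r u = [] then tops_below r u else insert (last (r u)) (tops_below r u))"
  by (auto simp: tops_below_def less_Suc_eq)

lemma tops_below_mono: "u \<le> v \<Longrightarrow> tops_below r u \<subseteq> tops_below r v"
  by (auto simp: tops_below_def)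

section \<open>Lindenbaum's construction along \<open>f\<close>, and why it yields a
  completion\<close>

primrec greedy :: "axioms \<Rightarrow> (nat \<Rightarrow> nat) \<Rightarrow> nat \<Rightarrow> nat \<Rightarrow> nat set" where
  "greedy H f c 0 = {}"
| "greedy H f c (Suc u) =
     (if c \<in> app H (insert (f u) (greedy H f c u)) then greedy H f c u
      else insert (f u) (greedy H f c u))"

lemma greedy_mono: "u \<le> v \<Longrightarrow> greedy H f c u \<subseteq> greedy H f c v"
  by (rule lift_Suc_mono_le) auto

lemma app_greedy_mono: "u \<le> v \<Longrightarrow> app H (greedy H f c u) \<subseteq> app H (greedy H f c v)"
  by (rule app_mono[OF order_refl greedy_mono])

lemma greedy_consistent: "c \<notin> app H {} \<Longrightarrow> c \<notin> app H (greedy H f c u)"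
  by (induction u) auto

lemma connectives_contradiction:
  assumes "connectives H c neg imp con dis"
  shows "c \<in> app H {x, neg x}"
proof -
  have "\<forall>x. c \<in> app H {x, neg x}"
    using assms unfolding connectives_def by (elim conjE) assumption
  then show ?thesis ..
qed

lemma connectives_negI:
  assumes "connectives H c neg imp con dis" and "c \<in> app H (insert x X)"
  shows "neg x \<in> app H X"
proof -
  have "\<forall>X x. c \<in> app H (X \<union> {x}) \<longrightarrow> neg x \<in> app H X"
    using assms(1) unfolding connectives_def by (elim conjE) assumption
  then show ?thesis using assms(2) by simp
qed

lemma card_Int_doubleton:
  assumes "x \<in> A \<or> y \<in> A" and "\<not> (x \<in> A \<and> y \<in> A)"
  shows "card (A \<inter> {x, y}) = 1"
proof -
  have "A \<inter> {x, y} = (if x \<in> A then {x} else {y})" using assms by auto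
  then show ?thesis by simp
qed

text \<open>When \<open>x = f u\<close> has its turn, it is either kept or refuted by what was kept
  before, and a refutation puts \<open>neg x\<close> into the closure. If both were derivable, they
  would lie in the closure of one common stage, because the stages increase, and that closure is
  consistent.\<close>

lemma greedy_completion:
  assumes "algebraic_closure H" and "surj f" and "connectives H c neg imp con dis"
    and cons: "c \<notin> app H {}" and ne: "\<And>x. neg x \<noteq> x"
  shows "completion neg (\<Union>u. app H (greedy H f c u))"
  unfolding completion_def
proof
  fix x
  let ?A = "\<Union>u. app H (greedy H f c u)"
  obtain u where u: "x = f u" using assms(2) by blast
  have some: "x \<in> ?A \<or> neg x \<in> ?A"
  proof (cases "c \<in> app H (insert (f u) (greedy H f c u))")
    case True
    then have "neg x \<in> app H (greedy H f c u)"
      unfolding u by (rule connectives_negI[OF assms(3)])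
    then show ?thesis by blast
  next
    case False
    then have "x \<in> app H (greedy H f c (Suc u))"
      using subset_app[OF assms(1), of "greedy H f c (Suc u)"] u by auto
    then show ?thesis by blast
  qed
  have "\<not> (x \<in> ?A \<and> neg x \<in> ?A)"
  proof
    assume "x \<in> ?A \<and> neg x \<in> ?A"
    then obtain u v where
      "x \<in> app H (greedy H f c u)" "neg x \<in> app H (greedy H f c v)" by auto
    then have "{x, neg x} \<subseteq> app H (greedy H f c (max u v))"
      using app_greedy_mono[of u "max u v" H f c] app_greedy_mono[of v "max u v" H f c]
      by auto
    then have "app H {x, neg x} \<subseteq> app H (greedy H f c (max u v))"
      by (rule app_absorb[OF assms(1)])
    moreover have "c \<in> app H {x, neg x}"
      using assms(3) by (rule connectives_contradiction)
    ultimately show False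
      using greedy_consistent[OF cons] by blast
  qed
  with some show "card (?A \<inter> {x, neg x}) = 1"
    by (rule card_Int_doubleton)
qed

section \<open>Least witnesses and sequences tending to infinity\<close>

lemma first_witness:
  fixes m :: nat
  assumes "\<exists>k\<le>m. P k"
  obtains k where "k \<le> m" "P k" "\<And>k'. k' < k \<Longrightarrow> \<not> P k'"
proof (rule that[of "LEAST k. P k"])
  show "(LEAST k. P k) \<le> m" using assms Least_le[of P] by (meson le_trans)
  show "P (LEAST k. P k)" using assms LeastI_ex[of P] by blast
qed (rule not_less_Least)

text \<open>Take the last stage from \<open>t\<close> on at which \<open>m\<close> attains its
  minimum over these stages; it exists because \<open>m\<close> tends to infinity. When
  \<open>m\<close> is the height of a run, all slots below the height are final from such a stage
  on.\<close>

lemma last_minimum_at_infinity: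
  fixes m :: "nat \<Rightarrow> nat"
  assumes "\<And>u. \<exists>t. \<forall>s\<ge>t. u \<le> m s"
  shows "\<exists>s\<ge>t. \<forall>s'>s. m s < m s'"
proof -
  obtain s0 where s0: "s0 \<ge> t" "\<And>s. s \<ge> t \<Longrightarrow> m s0 \<le> m s"
    using exists_least_iff[of "\<lambda>n. \<exists>s\<ge>t. m s = n"] by (metis le_refl linorder_not_le)
  obtain T where T: "\<And>s. s \<ge> T \<Longrightarrow> m s0 < m s"
    using assms[of "Suc (m s0)"] by (auto simp: Suc_le_eq)
  let ?S = "{s. s \<ge> t \<and> m s = m s0}"
  have "?S \<subseteq> {..<T}" using T by (force simp: not_less[symmetric])
  then have fin: "finite ?S" by (rule finite_subset) simp
  have in_S: "Max ?S \<in> ?S" using Max_in[OF fin] s0(1) by blast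
  have "m (Max ?S) < m s'" if "s' > Max ?S" for s'
  proof -
    have "s' \<notin> ?S" using that Max_ge[OF fin] by (metis linorder_not_less)
    then show ?thesis using s0(2)[of s'] in_S that by auto
  qed
  then show ?thesis using in_S by blast
qed

text \<open>The closure condition in \<open>step_revise\<close> is what the two procedures share: the revised slot
  is empty in the dialectical one, and in the \<open>p\<close>-dialectical one its top is the negation of a
  formula that the tops below refute.\<close>

locale revision_procedure =
  fixes H :: axioms and f :: "nat \<Rightarrow> nat" and c :: nat and \<alpha> :: "nat \<Rightarrow> axioms"
    and step :: "axioms \<Rightarrow> state \<Rightarrow> state"
  assumes closure: "algebraic_closure H"
    and approx: "computable_approximation H \<alpha>"
    and consistent: "c \<notin> app H {}"
    and step_advance:
      "(\<And>k. k \<le> m \<Longrightarrow> c \<notin> chi Hs r k) \<Longrightarrow> step Hs (m, r) = advance f (m, r)"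
    and step_revise:
      "Hs \<subseteq> H \<Longrightarrow> k \<le> m \<Longrightarrow> c \<in> chi Hs r k \<Longrightarrow> (\<And>k'. k' < k \<Longrightarrow> c \<notin> chi Hs r k') \<Longrightarrow>
         step Hs (m, r) = (m', r') \<Longrightarrow>
         (m' = k \<or> m' = k + 1 \<and> r' (k + 1) = [f (k + 1)]) \<and> (\<forall>v<k. r' v = r v) \<and>
         app H (tops_below r' (k + 1)) = app H (tops_below r k)"
begin

section \<open>Runs of a revision procedure, stage by stage\<close>

definition height :: "nat \<Rightarrow> nat" where
  "height s = fst (run f step \<alpha> s)"

definition stacks :: "nat \<Rightarrow> nat \<Rightarrow> nat list" where
  "stacks s = snd (run f step \<alpha> s)"

abbreviation L :: "nat \<Rightarrow> nat \<Rightarrow> nat set" where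
  "L s \<equiv> tops_below (stacks s)"

text \<open>The shift to \<open>Suc k\<close> is that of \<open>chi\<close>: the refutation found at
  slot \<open>k\<close> may use the top of slot \<open>k\<close> itself.\<close>

abbreviation revised_at :: "nat \<Rightarrow> nat \<Rightarrow> bool" where
  "revised_at s k \<equiv> k \<le> height s \<and> c \<in> app (\<alpha> s) (L s (Suc k)) \<and>
     (\<forall>k'<k. c \<notin> app (\<alpha> s) (L s (Suc k')))"

text \<open>Describes a revised slot without saying whether it is empty or holds a negation: all
  that matters is that its content adds nothing to the closure of the tops below.\<close>

definition rejected :: "nat \<Rightarrow> nat \<Rightarrow> bool" where
  "rejected s u \<longleftrightarrow> c \<in> app H (insert (f u) (L s u)) \<and> app H (L s (Suc u)) = app H (L s u)"

lemma run_eq: "run f step \<alpha> s = (height s, stacks s)"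
  by (simp add: height_def stacks_def)

text \<open>The case split behind every argument about a single stage. After a revision at
  \<open>k\<close> nothing is claimed about the slots above \<open>k\<close>, except for slot
  \<open>Suc k\<close> when the height reaches it.\<close>

lemma step_cases:
  obtains (advanced) "height (Suc s) = Suc (height s)"
      "\<And>v. v \<le> height s \<Longrightarrow> stacks (Suc s) v = stacks s v"
      "stacks (Suc s) (Suc (height s)) = [f (Suc (height s))]"
      "\<And>k. k \<le> height s \<Longrightarrow> c \<notin> app (\<alpha> s) (L s (Suc k))"
  | (revised) k where "revised_at s k"
      "height (Suc s) = k \<or> height (Suc s) = Suc k \<and> stacks (Suc s) (Suc k) = [f (Suc k)]"
      "\<And>v. v < k \<Longrightarrow> stacks (Suc s) v = stacks s v"
      "app H (L (Suc s) (Suc k)) = app H (L s k)"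
proof (cases "\<exists>k\<le>height s. c \<in> chi (\<alpha> s) (stacks s) k")
  case True
  then obtain k where k: "k \<le> height s" "c \<in> chi (\<alpha> s) (stacks s) k"
      "\<And>k'. k' < k \<Longrightarrow> c \<notin> chi (\<alpha> s) (stacks s) k'"
    by (rule first_witness) (rule that)
  have "step (\<alpha> s) (height s, stacks s) = (height (Suc s), stacks (Suc s))"
    unfolding run_eq[symmetric] by simp
  note revision = step_revise[OF approximation_subset[OF approx] k this]
  show ?thesis
  proof (rule revised[of k])
    show "revised_at s k" using k by (simp add: chi_def)
  qed (use revision in simp_all)
next
  case False
  then have "(height (Suc s), stacks (Suc s)) = advance f (height s, stacks s)"
    using step_advance[of "height s" "\<alpha> s" "stacks s"] unfolding run_eq[symmetric] by auto
  then have high: "height (Suc s) = Suc (height s)" and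
    st: "stacks (Suc s) = (\<lambda>x. if x < height s + 1 then stacks s x
       else if x = height s + 1 then [f (height s + 1)] else [])"
    by (simp_all add: advance_def)
  show ?thesis
  proof (rule advanced)
    show "height (Suc s) = Suc (height s)" by (fact high)
    show "stacks (Suc s) v = stacks s v" if "v \<le> height s" for v
      using that by (simp add: st)
    show "stacks (Suc s) (Suc (height s)) = [f (Suc (height s))]" by (simp add: st)
    show "c \<notin> app (\<alpha> s) (L s (Suc k))" if "k \<le> height s" for k
      using False that by (simp add: chi_def)
  qed
qed

lemma app_approx_subset: "app (\<alpha> s) X \<subseteq> app H X"
  by (rule app_mono[OF approximation_subset[OF approx] order_refl])

text \<open>Induction on the stage; the slots below \<open>u\<close> need not have stabilised. If
  slot \<open>u\<close> is revised while it holds \<open>f u\<close>, the contradiction just found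
  refutes \<open>f u\<close> over the tops below; if it was rejected before, that refutation is
  already at hand.\<close>

lemma settled_slot: "u \<le> height s \<Longrightarrow> stacks s u = [f u] \<or> rejected s u"
proof (induction s arbitrary: u)
  case 0
  then show ?case by (auto simp: height_def stacks_def start_def)
next
  case (Suc s)
  show ?case
  proof (cases s rule: step_cases)
    case advanced
    show ?thesis
    proof (cases "u \<le> height s")
      case True
      have "L (Suc s) u = L s u" "L (Suc s) (Suc u) = L s (Suc u)"
        using True advanced(2) by (auto intro!: tops_below_cong)
      then show ?thesis
        using Suc.IH[OF True] advanced(2)[OF True] by (simp add: rejected_def)
    next
      case False
      then have "u = Suc (height s)" using Suc.prems advanced(1) by simp
      then show ?thesis using advanced(3) by simp
    qed
  next
    case (revised k)
    consider "u < k" | "u = k" | "u = Suc k" "stacks (Suc s) (Suc k) = [f (Suc k)]"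
      using revised(2) Suc.prems by fastforce
    then show ?thesis
    proof cases
      case 1
      have "L (Suc s) u = L s u" "L (Suc s) (Suc u) = L s (Suc u)"
        using 1 revised(3) by (auto intro!: tops_below_cong)
      then show ?thesis
        using Suc.IH[of u] revised(1) revised(3)[of u] 1 by (simp add: rejected_def)
    next
      case 2
      have eq: "L (Suc s) k = L s k"
        using revised(3) by (auto intro!: tops_below_cong)
      have "c \<in> app H (L s (Suc k))"
        using revised(1) app_approx_subset by blast
      then have "c \<in> app H (insert (f k) (L s k))"
        using Suc.IH[of k] revised(1) by (auto simp: rejected_def tops_below_Suc)
      then show ?thesis using 2 eq revised(4) by (simp add: rejected_def)
    qed simp
  qed
qed

section \<open>Stabilisation of the slots\<close>

text \<open>A revision below \<open>u\<close> would use only tops that belong to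
  \<open>L s u\<close>, hence would refute that set.\<close>

lemma revised_beyond:
  assumes "c \<notin> app H (L s u)" and "revised_at s k"
  shows "u \<le> k"
proof (rule ccontr)
  assume "\<not> u \<le> k"
  then have "app (\<alpha> s) (L s (Suc k)) \<subseteq> app H (L s u)"
    by (intro app_mono[OF approximation_subset[OF approx]] tops_below_mono) simp
  then show False using assms by blast
qed

text \<open>A finite injury argument. Once the slots below \<open>u\<close> have settled, slot
  \<open>u\<close> is revised at most once more, since a rejected slot adds nothing to a consistent
  closure. Its final content then has the effect of the greedy choice, because every refutation is
  eventually enumerated.\<close>

lemma stable:
  "\<exists>t. \<forall>s\<ge>t. u \<le> height s \<and> (\<forall>v<u. stacks s v = stacks t v) \<and>
     app H (L s u) = app H (greedy H f c u)"
proof (induction u)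
  case 0
  show ?case by simp
next
  case (Suc u)
  then obtain t where t: "\<And>s. s \<ge> t \<Longrightarrow> u \<le> height s"
      "\<And>s v. s \<ge> t \<Longrightarrow> v < u \<Longrightarrow> stacks s v = stacks t v"
      "\<And>s. s \<ge> t \<Longrightarrow> app H (L s u) = app H (greedy H f c u)" by blast
  have cons: "c \<notin> app H (L s u)" if "s \<ge> t" for s
    using t(3)[OF that] greedy_consistent[OF consistent] by simp
  have L_eq: "L s u = L t u" if "s \<ge> t" for s
    using t(2)[OF that] by (rule tops_below_cong)
  have ins: "app H (insert (f u) (L s u)) = app H (insert (f u) (greedy H f c u))" if "s \<ge> t" for s
    using app_insert_cong[OF closure t(3)[OF that]] .
  \<comment> \<open>An advance lifts the height above \<open>u\<close>; a revision not at
    \<open>u\<close> happens at some \<open>k > u\<close> and leaves the height at \<open>k\<close>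
    or above.\<close>
  have keep: "stacks (Suc s) u = stacks s u \<and> Suc u \<le> height (Suc s)"
    if "s \<ge> t" "\<not> revised_at s u" for s
  proof (cases s rule: step_cases)
    case advanced
    then show ?thesis using t(1)[OF that(1)] by simp
  next
    case (revised k)
    have "u \<le> k" using revised_beyond[OF cons[OF that(1)] revised(1)] .
    moreover have "k \<noteq> u" using revised(1) that(2) by blast
    ultimately show ?thesis using revised(2,3) by auto
  qed
  have no_revision: "\<not> revised_at s u" if "s \<ge> t" "rejected s u" for s
  proof
    assume "revised_at s u"
    then have "c \<in> app H (L s (Suc u))" using app_approx_subset by blast
    then show False using that(2) cons[OF that(1)] by (simp add: rejected_def)
  qed
  obtain t' where t': "t' \<ge> t" "\<And>s. s \<ge> t' \<Longrightarrow> \<not> revised_at s u"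
  proof (cases "\<exists>s\<ge>t. revised_at s u")
    case False
    then show ?thesis using that[of t] by blast
  next
    case True
    then obtain s0 where s0: "s0 \<ge> t" "revised_at s0 u" by blast
    \<comment> \<open>Rejection is permanent: it holds right after the revision at
      \<open>s0\<close>, and as long as it holds there is no further revision that could alter slot
      \<open>u\<close>.\<close>
    have *: "rejected s u" if "s \<ge> Suc s0" for s
      using that
    proof (induction s rule: dec_induct)
      case base
      show ?case
      proof (cases s0 rule: step_cases)
        case advanced
        then show ?thesis using s0(2) by blast
      next
        case (revised k)
        \<comment> \<open>Both \<open>k\<close> and \<open>u\<close> are the least slot at which the
          contradiction shows at stage \<open>s0\<close>.\<close>
        have "\<not> k < u" "\<not> u < k" using revised(1) s0(2) by blast+
        then have "k = u" by simp
        have "c \<in> app H (L s0 (Suc u))" using s0(2) app_approx_subset by blast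
        moreover have "stacks s0 u = [f u] \<or> rejected s0 u"
          using settled_slot t(1)[OF s0(1)] by blast
        ultimately have "c \<in> app H (insert (f u) (L s0 u))"
          by (auto simp: rejected_def tops_below_Suc)
        then show ?thesis
          using revised(4) L_eq[of s0] L_eq[of "Suc s0"] s0(1) \<open>k = u\<close>
          by (simp add: rejected_def)
      qed
    next
      case (step s)
      then have "s \<ge> t" using s0(1) by simp
      have "stacks (Suc s) u = stacks s u"
        using keep[OF \<open>s \<ge> t\<close> no_revision[OF \<open>s \<ge> t\<close> step.IH]] by simp
      moreover have "L (Suc s) u = L s u"
        using L_eq[of s] L_eq[of "Suc s"] \<open>s \<ge> t\<close> by simp
      ultimately have "L (Suc s) (Suc u) = L s (Suc u)"
        by (simp add: tops_below_Suc)
      then show ?case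
        using step.IH \<open>L (Suc s) u = L s u\<close> by (simp add: rejected_def)
    qed
    show ?thesis
    proof (rule that[of "Suc s0"])
      show "\<not> revised_at s u" if "s \<ge> Suc s0" for s
        by (rule no_revision[OF _ *[OF that]]) (use that s0(1) in simp)
    qed (use s0(1) in simp)
  qed
  have same: "stacks s u = stacks t' u" if "s \<ge> t'" for s
    using that
  proof (induction s rule: dec_induct)
    case (step s)
    then show ?case using keep[of s] t' by simp
  qed simp
  have closed: "app H (L s (Suc u)) = app H (greedy H f c (Suc u))" if "s \<ge> t'" for s
  proof -
    have st: "s \<ge> t" using that t'(1) by simp
    have "stacks s u = [f u] \<or> rejected s u"
      using settled_slot t(1)[OF st] by blast
    then consider "rejected s u" | "stacks s u = [f u]" "c \<notin> app H (insert (f u) (L s u))"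
      | "stacks s u = [f u]" "c \<in> app H (insert (f u) (L s u))" by blast
    then show ?thesis
    proof cases
      case 1
      then show ?thesis using ins[OF st] t(3)[OF st] by (simp add: rejected_def)
    next
      case 2
      then show ?thesis using ins[OF st] by (simp add: tops_below_Suc)
    next
      \<comment> \<open>This case is impossible: the derivation of \<open>c\<close> is enumerated at
        some stage \<open>max w0 t'\<close>, and that stage would revise slot \<open>u\<close>,
        which no stage from \<open>t'\<close> on does.\<close>
      case 3
      have L_same: "L w (Suc u) = insert (f u) (L s u)" if "w \<ge> t'" for w
      proof -
        have "stacks w u = [f u]"
          using same[OF that] same[OF \<open>s \<ge> t'\<close>] 3(1) by simp
        moreover have "L w u = L s u"
          using L_eq[of w] L_eq[OF st] that t'(1) by simp
        ultimately show ?thesis by (simp add: tops_below_Suc)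
      qed
      obtain w0 where "\<And>w. w \<ge> w0 \<Longrightarrow> c \<in> app (\<alpha> w) (insert (f u) (L s u))"
        using app_approximation[OF approx 3(2)] by blast
      then have w: "c \<in> app (\<alpha> (max w0 t')) (L (max w0 t') (Suc u))" (is "c \<in> app (\<alpha> ?w) _")
        using L_same by simp
      have wt: "?w \<ge> t" using t'(1) by simp
      have "c \<notin> app (\<alpha> ?w) (L ?w (Suc k))" if "k < u" for k
      proof
        assume "c \<in> app (\<alpha> ?w) (L ?w (Suc k))"
        moreover have "app (\<alpha> ?w) (L ?w (Suc k)) \<subseteq> app H (L ?w u)"
          using that by (intro app_mono[OF approximation_subset[OF approx]] tops_below_mono) simp
        ultimately show False using cons[OF wt] by blast
      qed
      then have "revised_at ?w u" using w t(1)[OF wt] by blast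
      then show ?thesis using t'(2)[of ?w] by simp
    qed
  qed
  \<comment> \<open>One stage later than \<open>t'\<close>, because the bound on the height is known
    only after a stage without revision of \<open>u\<close> has been carried out.\<close>
  have high: "Suc u \<le> height s" if "s \<ge> Suc t'" for s
  proof -
    obtain w where "s = Suc w" "w \<ge> t'" using \<open>s \<ge> Suc t'\<close> Suc_le_D[of t' s] by auto
    then show ?thesis using keep[of w] t' by simp
  qed
  have "stacks s v = stacks (Suc t') v" if "s \<ge> Suc t'" "v < Suc u" for s v
    using that t(2)[of s v] t(2)[of "Suc t'" v] same[of s] same[of "Suc t'"] t'(1)
    by (cases "v = u") auto
  then show ?case
    using high closed by (meson Suc_leD)
qed

section \<open>From stable slots to the final theses\<close>

lemma theses_eq: "theses f step \<alpha> s = (\<Union>i<height s. app (\<alpha> s) (L s (Suc i)))"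
  by (simp add: theses_def run_eq chi_def)

text \<open>A revision at \<open>k\<close> leaves the height at most \<open>k + 1\<close>. As the
  height stays above \<open>height s\<close>, this forces
  \<open>k \<ge> height s > v\<close>.\<close>

lemma slot_preserved:
  assumes "\<And>s'. s' > s \<Longrightarrow> height s < height s'" and "v < height s" and "w \<ge> s"
  shows "stacks w v = stacks s v"
  using assms(3)
proof (induction w rule: dec_induct)
  case (step w)
  have "stacks (Suc w) v = stacks w v"
  proof (cases w rule: step_cases)
    case advanced
    then show ?thesis
      using assms(1)[of w] assms(2) step.hyps by (cases "w = s") auto
  next
    case (revised k)
    then show ?thesis using assms(1)[of "Suc w"] assms(2) step.hyps by auto
  qed
  then show ?case using step.IH by simp
qed simp

lemma final_theses_greedy:
  assumes "surj f"
  shows "final_theses f step \<alpha> = (\<Union>u. app H (greedy H f c u))"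
proof (intro equalityI subsetI)
  fix x assume "x \<in> final_theses f step \<alpha>"
  then obtain t where t: "\<And>s. s \<ge> t \<Longrightarrow> x \<in> theses f step \<alpha> s"
    by (auto simp: final_theses_def)
  have "\<exists>t. \<forall>s\<ge>t. u \<le> height s" for u
    using stable[of u] by blast
  \<comment> \<open>The slot that witnesses \<open>x\<close> among the theses may change with the
    stage. At a stage whose height is exceeded ever after, the slots below the height are final, so
    the witness found there persists.\<close>
  then obtain s where s: "s \<ge> t" "\<And>s'. s' > s \<Longrightarrow> height s < height s'"
    using last_minimum_at_infinity[of height t] by blast
  then obtain i where i: "i < height s" "x \<in> app (\<alpha> s) (L s (Suc i))"
    using t by (auto simp: theses_eq)
  obtain t' where t': "\<And>w. w \<ge> t' \<Longrightarrow> app H (L w (Suc i)) = app H (greedy H f c (Suc i))"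
    using stable[of "Suc i"] by blast
  let ?w = "max s t'"
  have "L ?w (Suc i) = L s (Suc i)"
    using i(1) by (intro tops_below_cong slot_preserved[OF s(2)]) simp_all
  then have "x \<in> app H (greedy H f c (Suc i))"
    using t'[of ?w] subsetD[OF app_approx_subset i(2)] by (simp del: greedy.simps)
  then show "x \<in> (\<Union>u. app H (greedy H f c u))" by blast
next
  fix x assume "x \<in> (\<Union>u. app H (greedy H f c u))"
  then obtain u where "x \<in> app H (greedy H f c u)" by blast
  \<comment> \<open>The theses are built from \<open>L s (Suc i)\<close> only, so the index has to
    be a successor.\<close>
  then have x: "x \<in> app H (greedy H f c (Suc u))"
    using app_greedy_mono[of u "Suc u" H f c] by auto
  obtain t where t: "\<And>s. s \<ge> t \<Longrightarrow> Suc u \<le> height s"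
      "\<And>s v. s \<ge> t \<Longrightarrow> v < Suc u \<Longrightarrow> stacks s v = stacks t v"
      "\<And>s. s \<ge> t \<Longrightarrow> app H (L s (Suc u)) = app H (greedy H f c (Suc u))"
    using stable[of "Suc u"] by blast
  have "x \<in> app H (L t (Suc u))" using x t(3)[of t] by simp
  then obtain t' where t': "\<And>s. s \<ge> t' \<Longrightarrow> x \<in> app (\<alpha> s) (L t (Suc u))"
    using app_approximation[OF approx] by blast
  have "x \<in> theses f step \<alpha> s" if "s \<ge> max t t'" for s
  proof -
    have "L s (Suc u) = L t (Suc u)"
      using that by (intro tops_below_cong t(2)) simp_all
    then have "x \<in> app (\<alpha> s) (L s (Suc u))" using that t'[of s] by simp
    moreover have "u < height s" using that t(1)[of s] by simp
    ultimately show ?thesis unfolding theses_eq by blast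
  qed
  moreover have "x \<in> range f" using assms by simp
  ultimately show "x \<in> final_theses f step \<alpha>"
    unfolding final_theses_def by blast
qed

end

section \<open>Both procedures as instances\<close>

lemma Least_eq_bounded:
  fixes k m :: nat
  assumes "k \<le> m" "P k" "\<And>k'. k' < k \<Longrightarrow> \<not> P k'"
  shows "(LEAST k. k \<le> m \<and> P k) = k"
  using assms by (intro Least_equality) (auto simp: not_less[symmetric])

lemma p_step_revise:
  assumes "k \<le> m" "c \<in> chi Hs r k" "\<And>k'. k' < k \<Longrightarrow> c \<notin> chi Hs r k'"
  shows "p_step f fm c Hs (m, r) = replace_at fm k (m, r)"
  using assms Least_eq_bounded[of k m "\<lambda>k. c \<in> chi Hs r k"] by (auto simp: p_step_def)

lemma d_step_revise:
  assumes "k \<le> m" "c \<in> chi Hs r k" "\<And>k'. k' < k \<Longrightarrow> c \<notin> chi Hs r k'"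
  shows "d_step f c Hs (m, r) = discard_at f c Hs k (m, r)"
  using assms Least_eq_bounded[of k m "\<lambda>k. c \<in> chi Hs r k"] by (auto simp: d_step_def)

lemma p_revision_procedure:
  assumes "algebraic_closure H" "computable_approximation H \<alpha>" "c \<notin> app H {}"
    and "connectives H c neg imp con dis"
  shows "revision_procedure H f c \<alpha> (p_step f neg c)"
proof
  fix Hs m r assume "\<And>k. k \<le> m \<Longrightarrow> c \<notin> chi Hs r k"
  then show "p_step f neg c Hs (m, r) = advance f (m, r)" by (auto simp: p_step_def)
next
  fix Hs k m r m' r'
  assume Hs: "Hs \<subseteq> H" and k: "k \<le> m" "c \<in> chi Hs r k" "\<And>k'. k' < k \<Longrightarrow> c \<notin> chi Hs r k'"
    and st: "p_step f neg c Hs (m, r) = (m', r')"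
  have r': "m' = k" "\<And>v. v < k \<Longrightarrow> r' v = r v" "r' k = r k @ [neg (last (r k))]"
    using st p_step_revise[OF k, of f neg] by (auto simp: replace_at_def)
  \<comment> \<open>Also right for an empty \<open>r k\<close>: its unspecified \<open>last\<close>
    then only enlarges the set on the right.\<close>
  have "chi Hs r k \<subseteq> app H (insert (last (r k)) (tops_below r k))"
    unfolding chi_def using Hs by (intro app_mono) (auto simp: tops_below_Suc)
  then have "neg (last (r k)) \<in> app H (tops_below r k)"
    using connectives_negI[OF assms(4)] k(2) by blast
  moreover have "tops_below r' k = tops_below r k"
    using r'(2) by (rule tops_below_cong)
  ultimately have "app H (tops_below r' (k + 1)) = app H (tops_below r k)"
    using r'(3) app_insert_absorb[OF assms(1)] by (simp add: tops_below_Suc)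
  then show "(m' = k \<or> m' = k + 1 \<and> r' (k + 1) = [f (k + 1)]) \<and> (\<forall>v<k. r' v = r v) \<and>
       app H (tops_below r' (k + 1)) = app H (tops_below r k)"
    using r' by blast
qed (use assms in auto)

lemma d_revision_procedure:
  assumes "algebraic_closure H" "computable_approximation H \<alpha>" "c \<notin> app H {}"
  shows "revision_procedure H f c \<alpha> (d_step f c)"
proof
  fix Hs m r assume "\<And>k. k \<le> m \<Longrightarrow> c \<notin> chi Hs r k"
  then show "d_step f c Hs (m, r) = advance f (m, r)" by (auto simp: d_step_def)
next
  fix Hs k m r m' r'
  assume Hs: "Hs \<subseteq> H" and k: "k \<le> m" "c \<in> chi Hs r k" "\<And>k'. k' < k \<Longrightarrow> c \<notin> chi Hs r k'"
    and st: "d_step f c Hs (m, r) = (m', r')"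
  \<comment> \<open>Excludes the branch of \<open>discard_at\<close> that restarts the whole
    run.\<close>
  have "c \<notin> app Hs {}" using app_mono[OF Hs order_refl] assms(3) by blast
  then have r': "m' = k + 1" "\<And>v. v < k \<Longrightarrow> r' v = r v" "r' k = []" "r' (k + 1) = [f (k + 1)]"
    using st d_step_revise[OF k, of f] by (auto simp: discard_at_def)
  moreover have "tops_below r' k = tops_below r k"
    using r'(2) by (rule tops_below_cong)
  ultimately show "(m' = k \<or> m' = k + 1 \<and> r' (k + 1) = [f (k + 1)]) \<and> (\<forall>v<k. r' v = r v) \<and>
       app H (tops_below r' (k + 1)) = app H (tops_below r k)"
    by (simp add: tops_below_Suc)
qed (use assms in auto)

section \<open>Looplessness gives consistency\<close>

text \<open>Otherwise slot 0 is revised at every late stage, and its tops run through an infinite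
  orbit of \<open>fm\<close>.\<close>

lemma loopless_consistent:
  assumes "p_dialectical_system H f fm c" and approx: "computable_approximation H \<alpha>"
    and "loopless f (p_step f fm c) \<alpha>"
  shows "c \<notin> app H {}"
proof
  assume "c \<in> app H {}"
  then obtain t where t: "\<And>s. s \<ge> t \<Longrightarrow> c \<in> app (\<alpha> s) {}"
    using app_approximation[OF approx] by blast
  define top where "top s = last (snd (run f (p_step f fm c) \<alpha> s) 0)" for s
  have next_top: "snd (run f (p_step f fm c) \<alpha> (Suc s)) 0 \<noteq> [] \<and> top (Suc s) = fm (top s)"
    if "s \<ge> t" for s
  proof -
    obtain m r where mr: "run f (p_step f fm c) \<alpha> s = (m, r)" by fastforce
    have "app (\<alpha> s) {} \<subseteq> chi (\<alpha> s) r 0"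
      unfolding chi_def by (rule app_mono) simp_all
    then have "c \<in> chi (\<alpha> s) r 0" using t[OF that] by blast
    then have "p_step f fm c (\<alpha> s) (m, r) = replace_at fm 0 (m, r)"
      by (intro p_step_revise) auto
    then show ?thesis by (simp add: top_def mr replace_at_def)
  qed
  \<comment> \<open>The count starts at \<open>Suc t\<close> because from there on
    \<open>next_top\<close> guarantees a nonempty stack.\<close>
  have iter: "top (Suc t + n) = (fm ^^ n) (top (Suc t))" for n
    using next_top by (induction n) auto
  let ?S = "{last (r 0) |r. (\<exists>s m. run f (p_step f fm c) \<alpha> s = (m, r)) \<and> r 0 \<noteq> []}"
  have "{(fm ^^ n) (top (Suc t)) |n. True} \<subseteq> ?S"
  proof
    fix x assume "x \<in> {(fm ^^ n) (top (Suc t)) |n. True}"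
    then obtain n where "x = top (Suc t + n)" using iter by auto
    moreover obtain m r where mr: "run f (p_step f fm c) \<alpha> (Suc t + n) = (m, r)" by fastforce
    moreover have "r 0 \<noteq> []"
      using next_top[of "t + n"] mr by simp
    ultimately show "x \<in> ?S"
      unfolding top_def by (intro CollectI exI[of _ r] conjI exI[of _ "Suc t + n"] exI[of _ m]) simp_all
  qed
  moreover have "finite ?S" using assms(3) by (simp add: loopless_def)
  moreover have "infinite {(fm ^^ n) (top (Suc t)) |n. True}"
    using assms(1) by (simp add: p_dialectical_system_def)
  ultimately show False by (meson finite_subset)
qed

section \<open>The \<open>q\<close>-procedure with both contradictions equal\<close>

text \<open>Clause (3) would need \<open>c\<close> both inside and outside the same set, so it never
  applies; clause (2) picks the same least slot as the dialectical step.\<close>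

lemma q_step_same: "q_step f fm c c = d_step f c"
proof (intro ext)
  fix Hs and \<sigma> :: state
  obtain m r where \<sigma>: "\<sigma> = (m, r)" by fastforce
  show "q_step f fm c c Hs \<sigma> = d_step f c Hs \<sigma>"
  proof (cases "\<exists>k\<le>m. c \<in> chi Hs r k")
    case True
    then obtain k where k: "k \<le> m" "c \<in> chi Hs r k" "\<And>k'. k' < k \<Longrightarrow> c \<notin> chi Hs r k'"
      by (rule first_witness) (rule that)
    let ?C = "\<lambda>k. k \<le> m \<and> c \<in> chi Hs r k \<and> (\<forall>k'<k. c \<notin> chi Hs r k')"
    have "\<exists>k. ?C k" using k by blast
    moreover have "(LEAST k. ?C k) = k"
      using k by (intro Least_eq_bounded) blast+
    ultimately have "q_step f fm c c Hs \<sigma> = discard_at f c Hs k (m, r)"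
      unfolding q_step_def \<sigma> Let_def by (simp only: prod.case if_True)
    then show ?thesis using d_step_revise[OF k] by (simp only: \<sigma>)
  next
    case False
    then have "\<not> (\<exists>k. k \<le> m \<and> c \<in> chi Hs r k \<and> P k)" for P by blast
    then have "q_step f fm c c Hs \<sigma> = advance f (m, r)"
      unfolding q_step_def \<sigma> Let_def by (simp only: prod.case if_False)
    moreover have "d_step f c Hs \<sigma> = advance f (m, r)"
      using False unfolding d_step_def \<sigma> by (simp only: prod.case if_False)
    ultimately show ?thesis by simp
  qed
qed

text \<open>A dialectical step keeps a slot, empties it or fills it with \<open>f u\<close>; nothing
  is ever appended.\<close>

lemma d_stack_tops:
  "snd (run f (d_step f c) \<alpha> s) u = [] \<or> snd (run f (d_step f c) \<alpha> s) u = [f u]"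
proof (induction s)
  case (Suc s)
  obtain m r where mr: "run f (d_step f c) \<alpha> s = (m, r)" by fastforce
  have r: "r u = [] \<or> r u = [f u]" using Suc.IH mr by simp
  have "snd (discard_at f c Hs z (m, r)) u \<in> {[], [f u]}" for Hs z
    using r by (auto simp: discard_at_def start_def)
  moreover have "snd (advance f (m, r)) u \<in> {[], [f u]}"
    using r by (auto simp: advance_def)
  moreover have "run f (d_step f c) \<alpha> (Suc s) = d_step f c (\<alpha> s) (m, r)"
    using mr by simp
  ultimately show ?case
    unfolding d_step_def by auto
qed (simp add: start_def)

lemma d_loopless: "loopless f (d_step f c) \<alpha>"
  unfolding loopless_def
proof
  fix u
  have "last (r u) = f u" if "run f (d_step f c) \<alpha> s = (m, r)" "r u \<noteq> []" for r s m
    using d_stack_tops[of f c \<alpha> s u] that by simp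
  then have "{last (r u) |r. (\<exists>s m. run f (d_step f c) \<alpha> s = (m, r)) \<and> r u \<noteq> []} \<subseteq> {f u}"
    by blast
  then show "finite {last (r u) |r. (\<exists>s m. run f (d_step f c) \<alpha> s = (m, r)) \<and> r u \<noteq> []}"
    by (rule finite_subset) simp
qed

lemma computable_add: "computable (\<lambda>x. x + n)"
proof (induction n)
  case 0
  have "evaluates (Proj 0) [x] x" for x
    using evaluates.proj[of 0 "[x]"] by simp
  then show ?case by (auto simp: computable_def)
next
  case (Suc n)
  then obtain e where "\<And>x. evaluates e [x] (x + n)" by (auto simp: computable_def)
  then have "evaluates (Comp Succ [e]) [x] (x + Suc n)" for x
    by (intro evaluates.comp[where ys = "[x + n]"]) (auto intro: evaluates.succ)
  then show ?case by (auto simp: computable_def)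
qed

text \<open>Shifting by \<open>Suc c\<close> makes every value exceed \<open>c\<close>, so
  \<open>c\<close> can serve as the second contradiction, and a positive shift has infinite
  orbits.\<close>

lemma q_dialectical_system_shift:
  assumes "dialectical_system H f c"
  shows "q_dialectical_system H f (\<lambda>x. x + Suc c) c c"
proof -
  have iter: "((\<lambda>x. x + Suc c) ^^ n) x = x + n * Suc c" for n x
    by (induction n) auto
  have "inj (\<lambda>n. x + n * Suc c)" for x
    by (rule injI) (simp del: mult_Suc_right)
  then have "infinite (range (\<lambda>n. x + n * Suc c))" for x
    using finite_imageD infinite_UNIV_nat by blast
  then have "infinite {((\<lambda>x. x + Suc c) ^^ n) x |n. True}" for x
    unfolding iter by (simp add: full_SetCompr_eq)
  moreover have "c \<notin> range (\<lambda>x. x + Suc c)" by auto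
  ultimately show ?thesis
    using assms computable_add[of "Suc c"]
    by (simp add: q_dialectical_system_def p_dialectical_system_def)
qed

theorem theorem4p7:
  fixes H :: axioms and f fm :: "nat \<Rightarrow> nat" and c :: nat
    and neg :: "nat \<Rightarrow> nat" and imp con dis :: "nat \<Rightarrow> nat \<Rightarrow> nat"
    and \<alpha> :: "nat \<Rightarrow> axioms"
  assumes "p_dialectical_system H f fm c"
    and "connectives H c neg imp con dis"
    and "fm = neg"
    and "computable_approximation H \<alpha>"
    and "loopless f (p_step f fm c) \<alpha>"
  shows "dialectical_completion (final_theses f (p_step f fm c) \<alpha>) \<and>
         q_dialectical_completion (final_theses f (p_step f fm c) \<alpha>)"
proof -
  have d: "dialectical_system H f c" and cl: "algebraic_closure H" and surj: "surj f"
    using assms(1) by (auto simp: p_dialectical_system_def dialectical_system_def bij_def)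
  have cons: "c \<notin> app H {}" by (rule loopless_consistent[OF assms(1,4,5)])
  \<comment> \<open>A fixed point would have a finite orbit under \<open>neg\<close>, which is
    \<open>fm\<close>.\<close>
  have ne: "neg x \<noteq> x" for x
  proof
    assume "neg x = x"
    then have "(neg ^^ n) x = x" for n by (induction n) auto
    then have "finite {(neg ^^ n) x |n. True}" by simp
    then show False using assms(1,3) by (simp add: p_dialectical_system_def)
  qed
  let ?A = "final_theses f (p_step f fm c) \<alpha>"
  have p: "?A = (\<Union>u. app H (greedy H f c u))"
    using revision_procedure.final_theses_greedy[OF p_revision_procedure[OF cl assms(4) cons assms(2)] surj]
      assms(3) by simp
  have eq: "?A = final_theses f (d_step f c) \<alpha>"
    using revision_procedure.final_theses_greedy[OF d_revision_procedure[OF cl assms(4) cons] surj] p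
    by simp
  have compl: "completion neg ?A"
    unfolding p by (rule greedy_completion[OF cl surj assms(2) cons ne])
  have "dialectical_completion ?A"
    unfolding dialectical_completion_def using d assms(2,4) eq compl by blast
  \<comment> \<open>The witnesses are the given \<open>H\<close>, \<open>f\<close>,
    \<open>c\<close>, connectives and \<open>\<alpha>\<close>, with the shift by
    \<open>Suc c\<close> as new replacement function and \<open>c\<close> as second
    contradiction.\<close>
  moreover have "q_dialectical_completion ?A"
    unfolding q_dialectical_completion_def
    using q_dialectical_system_shift[OF d] assms(2,4) compl eq d_loopless[of f c \<alpha>]
      q_step_same[of f "\<lambda>x. x + Suc c" c] by metis
  ultimately show ?thesis by blast
qed

end
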